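(* Let $X$ be a completely metrizable space. Then the set $\mathrm{Comp}(X)$ of all complete metrics in $\mathrm{Met}(X)$ is comeager in $(\mathrm{CPM}(X),\mathcal{D}_X)$. Moreover, the set $\mathrm{Comp}(X)$ is also comeager in $(\mathrm{Met}(X),\mathcal{D}_X)$.
   Context: A pseudometric on a set $X$ is a map $d\colon X\times X\to[0,\infty)$ with $d(x,x)=0$, $d(x,y)=d(y,x)$ and $d(x,y)\le d(x,z)+d(z,y)$ for all $x,y,z\in X$; it is a metric if $d(x,y)=0$ implies $x=y$. For a topological space $X$, $\mathrm{CPM}(X)$ denotes the set of all pseudometrics $d$ on $X$ that are continuous as maps $X\times X\to[0,\infty)$, and $\mathrm{Met}(X)\subseteq\mathrm{CPM}(X)$ denotes the set of all metrics on $X$ generating the same topology as that of $X$. Define $\mathcal{D}_X\colon \mathrm{CPM}(X)^2\to[0,\infty]$ by $\mathcal{D}_X(d,e)=\sup_{x,y\in X}|d(x,y)-e(x,y)|$; although it may take the value $\infty$, it induces a topology via open balls as for ordinary metrics. $\mathrm{CPM}(X)$ carries this topology, and $\mathrm{Met}(X)$ carries the topology induced by the restriction of $\mathcal{D}_X$ to $\mathrm{Met}(X)^2$, still written $\mathcal{D}_X$. A subset $S$ of a topological space $M$ is comeager if there is a sequence $\{G_n\}_{n\in\mathbb{Z}_{\ge0}}$ of open dense subsets of $M$ with $\bigcap_{n}G_n\subseteq S$. *)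

theory Defs
  imports "HOL-Analysis.Analysis"
begin

(* A pseudometric on S is a function on S x S. It is represented by a total function
   that vanishes off S x S, so that distinct functions represent distinct
   pseudometrics. The value 0 (rather than undefined) is forced by the library locale
   Metric_space, which requires nonnegativity and symmetry also outside the carrier. *)
definition pseudometric_on :: "'a set \<Rightarrow> ('a \<Rightarrow> 'a \<Rightarrow> real) \<Rightarrow> bool" where
  "pseudometric_on S d \<longleftrightarrow>
     (\<forall>x\<in>S. \<forall>y\<in>S. 0 \<le> d x y) \<and>
     (\<forall>x\<in>S. d x x = 0) \<and>
     (\<forall>x\<in>S. \<forall>y\<in>S. d x y = d y x) \<and>
     (\<forall>x\<in>S. \<forall>y\<in>S. \<forall>z\<in>S. d x y \<le> d x z + d z y) \<and>
     (\<forall>x y. x \<notin> S \<or> y \<notin> S \<longrightarrow> d x y = 0)"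

lemma Metric_space_iff_pseudometric_on:
  assumes "\<And>x y. x \<notin> S \<or> y \<notin> S \<Longrightarrow> d x y = 0"
  shows "Metric_space S d \<longleftrightarrow>
           pseudometric_on S d \<and> (\<forall>x\<in>S. \<forall>y\<in>S. d x y = 0 \<longrightarrow> x = y)"
proof
  assume "Metric_space S d"
  then interpret Metric_space S d .
  show "pseudometric_on S d \<and> (\<forall>x\<in>S. \<forall>y\<in>S. d x y = 0 \<longrightarrow> x = y)"
    unfolding pseudometric_on_def by (intro conjI ballI allI impI; (rule commute | simp add: assms triangle))
next
  assume R: "pseudometric_on S d \<and> (\<forall>x\<in>S. \<forall>y\<in>S. d x y = 0 \<longrightarrow> x = y)"
  show "Metric_space S d"
  proof
    show "0 \<le> d x y" for x y
      using R assms[of x y] unfolding pseudometric_on_def by (metis order_refl)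
    show "d x y = d y x" for x y
      using R assms unfolding pseudometric_on_def by metis
    show "d x y = 0 \<longleftrightarrow> x = y" if "x \<in> S" "y \<in> S" for x y
      using R that unfolding pseudometric_on_def by metis
    show "d x z \<le> d x y + d y z" if "x \<in> S" "y \<in> S" "z \<in> S" for x y z
      using R that unfolding pseudometric_on_def by blast
  qed
qed

definition CPM :: "'a topology \<Rightarrow> ('a \<Rightarrow> 'a \<Rightarrow> real) set" where
  "CPM X = {d. pseudometric_on (topspace X) d \<and>
               continuous_map (prod_topology X X) euclideanreal (\<lambda>(x, y). d x y)}"

definition Met :: "'a topology \<Rightarrow> ('a \<Rightarrow> 'a \<Rightarrow> real) set" where
  "Met X = {d. pseudometric_on (topspace X) d \<and> Metric_space (topspace X) d \<and>
               Metric_space.mtopology (topspace X) d = X}"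

lemma Met_subset_CPM: "Met X \<subseteq> CPM X"
proof
  fix d assume d: "d \<in> Met X"
  then interpret Metric_space "topspace X" d
    by (simp add: Met_def)
  have X: "mtopology = X"
    using d by (simp add: Met_def)
  have "continuous_map (prod_topology X X) euclideanreal (\<lambda>p. d (fst p) (snd p))"
    using continuous_map_mdist[of "prod_topology X X" "metric (topspace X, d)" fst snd]
    by (simp add: X continuous_map_fst continuous_map_snd)
  then show "d \<in> CPM X"
    using d by (simp add: CPM_def Met_def case_prod_unfold)
qed

definition Comp :: "'a topology \<Rightarrow> ('a \<Rightarrow> 'a \<Rightarrow> real) set" where
  "Comp X = {d \<in> Met X. Metric_space.mcomplete (topspace X) d}"

definition sup_dist ::
    "'a topology \<Rightarrow> ('a \<Rightarrow> 'a \<Rightarrow> real) \<Rightarrow> ('a \<Rightarrow> 'a \<Rightarrow> real) \<Rightarrow> ennreal" where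
  "sup_dist X d e = (SUP (x, y) \<in> topspace X \<times> topspace X. ennreal \<bar>d x y - e x y\<bar>)"

(* The analogue of Metric_space.mtopology for a distance that may be infinite. *)
definition ball_topology :: "'b set \<Rightarrow> ('b \<Rightarrow> 'b \<Rightarrow> ennreal) \<Rightarrow> 'b topology" where
  "ball_topology S D =
     topology (\<lambda>U. U \<subseteq> S \<and> (\<forall>x\<in>U. \<exists>r::real. 0 < r \<and> {y \<in> S. D x y < ennreal r} \<subseteq> U))"

lemma openin_ball_topology:
  "openin (ball_topology S D) U \<longleftrightarrow>
     U \<subseteq> S \<and> (\<forall>x\<in>U. \<exists>r::real. 0 < r \<and> {y \<in> S. D x y < ennreal r} \<subseteq> U)"
proof -
  let ?P = "\<lambda>U. U \<subseteq> S \<and> (\<forall>x\<in>U. \<exists>r::real. 0 < r \<and> {y \<in> S. D x y < ennreal r} \<subseteq> U)"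
  have "istopology ?P"
    unfolding istopology_def
  proof (intro conjI allI impI)
    fix U V assume U: "?P U" and V: "?P V"
    show "U \<inter> V \<subseteq> S" using U by blast
    show "\<forall>x\<in>U \<inter> V. \<exists>r::real. 0 < r \<and> {y \<in> S. D x y < ennreal r} \<subseteq> U \<inter> V"
    proof
      fix x assume "x \<in> U \<inter> V"
      then obtain r s :: real where rs:
        "0 < r" "{y \<in> S. D x y < ennreal r} \<subseteq> U" "0 < s" "{y \<in> S. D x y < ennreal s} \<subseteq> V"
        using U V by blast
      have "ennreal (min r s) \<le> ennreal r" "ennreal (min r s) \<le> ennreal s"
        by (simp_all add: ennreal_leI)
      then have "{y \<in> S. D x y < ennreal (min r s)} \<subseteq> U \<inter> V"
        using rs less_le_trans by blast
      then show "\<exists>r::real. 0 < r \<and> {y \<in> S. D x y < ennreal r} \<subseteq> U \<inter> V"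
        using rs by (intro exI[of _ "min r s"]) simp
    qed
  next
    fix K assume K: "\<forall>U\<in>K. ?P U"
    show "\<Union>K \<subseteq> S" using K by blast
    show "\<forall>x\<in>\<Union>K. \<exists>r::real. 0 < r \<and> {y \<in> S. D x y < ennreal r} \<subseteq> \<Union>K"
    proof
      fix x assume "x \<in> \<Union>K"
      then obtain U where "U \<in> K" "x \<in> U" by blast
      then obtain r :: real where "0 < r" "{y \<in> S. D x y < ennreal r} \<subseteq> U"
        using K by blast
      with \<open>U \<in> K\<close> show "\<exists>r::real. 0 < r \<and> {y \<in> S. D x y < ennreal r} \<subseteq> \<Union>K"
        by blast
    qed
  qed
  then show ?thesis
    by (simp add: ball_topology_def topology_inverse')
qed

lemma topspace_ball_topology [simp]: "topspace (ball_topology S D) = S"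
proof -
  have "openin (ball_topology S D) S"
    unfolding openin_ball_topology by (auto intro: exI[of _ 1])
  then show ?thesis
    by (meson openin_ball_topology openin_subset openin_topspace subset_antisym)
qed

definition comeager_in :: "'b topology \<Rightarrow> 'b set \<Rightarrow> bool" where
  "comeager_in T S \<longleftrightarrow> S \<subseteq> topspace T \<and>
     (\<exists>G :: nat \<Rightarrow> 'b set.
        (\<forall>n. openin T (G n) \<and> T closure_of (G n) = topspace T) \<and> (\<Inter>n. G n) \<subseteq> S)"

end

theory Submission
  imports Defs
begin

text \<open>
  Fix a complete metric \<open>\<rho>\<close> generating the topology of \<open>X\<close>. The theorem rests on the observation
  that it suffices to make \<open>d\<close> uniformly finer than \<open>\<rho>\<close>, which means that the identity from \<open>d\<close>
  to \<open>\<rho>\<close> is uniformly continuous. A continuous pseudometric \<open>d\<close> with this property separates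
  points, generates the topology of \<open>X\<close>, and is complete, because its Cauchy sequences are
  \<open>\<rho>\<close>-Cauchy and hence converge in \<open>X\<close> (\<open>uniformly_finer_imp_Comp\<close>).

  Uniform continuity is a conjunction of countably many conditions, one for each
  \<open>\<epsilon> = 1 / (n + 1)\<close>: some \<open>\<delta> > 0\<close> is such that \<open>d x y < \<delta>\<close> implies \<open>\<rho> x y < \<epsilon>\<close>. Each of these is
  open for the supremum distance, since changing \<open>d\<close> by less than \<open>\<delta> / 2\<close> only costs replacing
  \<open>\<delta>\<close> by \<open>\<delta> / 2\<close> (\<open>finer_at_scale_open\<close>). They are also dense: adding
  \<open>c * min 1 (\<rho> x y)\<close> moves \<open>d\<close> by at most \<open>c\<close> and makes it uniformly finer than \<open>\<rho>\<close> at once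
  (\<open>perturb_finer_at_scale\<close>).

  The perturbed pseudometric already lies in \<open>Comp X\<close>, so the argument works in every
  space between \<open>Comp X\<close> and \<open>CPM X\<close>, in particular in both spaces of the theorem.
\<close>

definition finer_at_scale ::
    "'a set \<Rightarrow> ('a \<Rightarrow> 'a \<Rightarrow> real) \<Rightarrow> real \<Rightarrow> ('a \<Rightarrow> 'a \<Rightarrow> real) \<Rightarrow> bool" where
  "finer_at_scale S \<rho> \<epsilon> d \<longleftrightarrow> (\<exists>\<delta>>0. \<forall>x\<in>S. \<forall>y\<in>S. d x y < \<delta> \<longrightarrow> \<rho> x y < \<epsilon>)"

definition perturb ::
    "'a set \<Rightarrow> ('a \<Rightarrow> 'a \<Rightarrow> real) \<Rightarrow> real \<Rightarrow> ('a \<Rightarrow> 'a \<Rightarrow> real) \<Rightarrow> 'a \<Rightarrow> 'a \<Rightarrow> real" where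
  "perturb S \<rho> c d x y = (if x \<in> S \<and> y \<in> S then d x y + c * min 1 (\<rho> x y) else 0)"

lemma closure_of_ball_topology_eq_carrier:
  assumes "\<And>x r. x \<in> S \<Longrightarrow> 0 < r \<Longrightarrow> \<exists>y\<in>G \<inter> S. D x y < ennreal r"
  shows "ball_topology S D closure_of G = S"
proof -
  have "\<exists>y\<in>G. y \<in> U" if "x \<in> U" "openin (ball_topology S D) U" for x U
    using that assms unfolding openin_ball_topology by fast
  then show ?thesis
    unfolding closure_of_def by auto
qed

lemma sup_dist_less_imp_abs_less:
  assumes "sup_dist X d e < ennreal r" "x \<in> topspace X" "y \<in> topspace X"
  shows "\<bar>d x y - e x y\<bar> < r"
proof -
  have "ennreal \<bar>d x y - e x y\<bar> \<le> sup_dist X d e"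
    unfolding sup_dist_def using assms(2,3) by (intro SUP_upper2[of "(x, y)"]) auto
  then have "ennreal \<bar>d x y - e x y\<bar> < ennreal r"
    using assms(1) by (rule le_less_trans)
  then show ?thesis
    by (simp add: ennreal_less_iff)
qed

lemma sup_dist_perturb_le:
  assumes "Metric_space (topspace X) \<rho>" "0 \<le> c"
  shows "sup_dist X d (perturb (topspace X) \<rho> c d) \<le> ennreal c"
proof -
  interpret R: Metric_space "topspace X" \<rho> by fact
  have "\<bar>c * min 1 (\<rho> x y)\<bar> \<le> c" for x y
    using assms(2) by (simp add: abs_mult mult_left_le)
  then show ?thesis
    unfolding sup_dist_def perturb_def by (intro SUP_least) (auto intro: ennreal_leI)
qed

lemma perturb_in_CPM:
  assumes R: "Metric_space (topspace X) \<rho>" and top: "Metric_space.mtopology (topspace X) \<rho> = X"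
    and d: "d \<in> CPM X" and c: "0 \<le> c"
  shows "perturb (topspace X) \<rho> c d \<in> CPM X"
proof -
  let ?S = "topspace X"
  interpret R: Metric_space ?S \<rho> by (fact R)
  have d': "pseudometric_on ?S d"
    and cont_d: "continuous_map (prod_topology X X) euclideanreal (\<lambda>p. d (fst p) (snd p))"
    using d by (auto simp: CPM_def case_prod_unfold)
  have "pseudometric_on ?S (perturb ?S \<rho> c d)"
    unfolding pseudometric_on_def
  proof (intro conjI ballI allI impI)
    fix x y z assume S: "x \<in> ?S" "y \<in> ?S" "z \<in> ?S"
    have "min 1 (\<rho> x y) \<le> min 1 (\<rho> x z) + min 1 (\<rho> z y)"
      using R.triangle[OF S(1,3,2)] R.nonneg[of x z] R.nonneg[of z y] by linarith
    from mult_left_mono[OF this c]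
    have "c * min 1 (\<rho> x y) \<le> c * min 1 (\<rho> x z) + c * min 1 (\<rho> z y)"
      by (simp only: distrib_left)
    moreover have "d x y \<le> d x z + d z y"
      using d' S unfolding pseudometric_on_def by blast
    ultimately show "perturb ?S \<rho> c d x y \<le> perturb ?S \<rho> c d x z + perturb ?S \<rho> c d z y"
      using S by (simp add: perturb_def)
  qed (use d' c in \<open>auto simp: pseudometric_on_def perturb_def R.commute\<close>)
  moreover
  have "continuous_map (prod_topology X X) euclideanreal (\<lambda>p. \<rho> (fst p) (snd p))"
    using continuous_map_mdist[of "prod_topology X X" "metric (?S, \<rho>)" fst snd]
    by (simp add: top continuous_map_fst continuous_map_snd)
  then have "continuous_map (prod_topology X X) euclideanreal
          (\<lambda>p. d (fst p) (snd p) + c * min 1 (\<rho> (fst p) (snd p)))"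
    by (intro continuous_map_add cont_d continuous_map_real_mult continuous_map_real_min) auto
  then have "continuous_map (prod_topology X X) euclideanreal (\<lambda>(x, y). perturb ?S \<rho> c d x y)"
    by (rule continuous_map_eq) (auto simp: perturb_def)
  ultimately show ?thesis
    by (simp add: CPM_def)
qed

text \<open>
  Truncating \<open>\<rho>\<close> at \<open>1\<close> keeps the perturbation small but leaves its small values unchanged, and
  these are what the uniform comparison sees.
\<close>

lemma perturb_finer_at_scale:
  assumes d: "pseudometric_on S d" and "0 < c" "0 < \<epsilon>"
  shows "finer_at_scale S \<rho> \<epsilon> (perturb S \<rho> c d)"
  unfolding finer_at_scale_def
proof (intro exI[of _ "c * min 1 \<epsilon>"] conjI ballI impI)
  fix x y assume S: "x \<in> S" "y \<in> S" and *: "perturb S \<rho> c d x y < c * min 1 \<epsilon>"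
  have "0 \<le> d x y"
    using d S by (simp add: pseudometric_on_def)
  with * S have "c * min 1 (\<rho> x y) < c * min 1 \<epsilon>"
    by (simp add: perturb_def)
  then show "\<rho> x y < \<epsilon>"
    using \<open>0 < c\<close> by (auto simp: min_def split: if_splits)
qed (use assms in auto)

text \<open>
  If \<open>\<delta>\<close> is a threshold for \<open>d\<close>, then \<open>\<delta> / 2\<close> is one for every \<open>e\<close> in the \<open>\<delta> / 2\<close>-ball
  around \<open>d\<close>.
\<close>

lemma finer_at_scale_open:
  assumes "finer_at_scale (topspace X) \<rho> \<epsilon> d"
  obtains r where "0 < r"
    "\<And>e. sup_dist X d e < ennreal r \<Longrightarrow> finer_at_scale (topspace X) \<rho> \<epsilon> e"
proof -
  obtain \<delta> where \<delta>: "\<delta> > 0"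
    "\<And>x y. x \<in> topspace X \<Longrightarrow> y \<in> topspace X \<Longrightarrow> d x y < \<delta> \<Longrightarrow> \<rho> x y < \<epsilon>"
    using assms unfolding finer_at_scale_def by blast
  have "finer_at_scale (topspace X) \<rho> \<epsilon> e" if e: "sup_dist X d e < ennreal (\<delta> / 2)" for e
    unfolding finer_at_scale_def
  proof (intro exI[of _ "\<delta> / 2"] conjI ballI impI)
    fix x y assume S: "x \<in> topspace X" "y \<in> topspace X" and "e x y < \<delta> / 2"
    then have "d x y < \<delta>"
      using sup_dist_less_imp_abs_less[OF e S] by linarith
    then show "\<rho> x y < \<epsilon>"
      using \<delta>(2) S by blast
  qed (use \<delta>(1) in simp)
  then show thesis
    using that[of "\<delta> / 2"] \<delta>(1) by simp
qed

text \<open>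
  Continuity of \<open>d\<close> makes the \<open>d\<close>-balls open in \<open>X\<close>, and the comparison with \<open>\<rho>\<close> makes the open
  sets of \<open>X\<close> open for \<open>d\<close>. Because the comparison is uniform, it also turns \<open>d\<close>-Cauchy
  sequences into \<open>\<rho>\<close>-Cauchy sequences.
\<close>

lemma uniformly_finer_imp_Comp:
  assumes R: "Metric_space (topspace X) \<rho>" and top: "Metric_space.mtopology (topspace X) \<rho> = X"
    and complete: "Metric_space.mcomplete (topspace X) \<rho>"
    and d: "d \<in> CPM X"
    and finer: "\<And>\<epsilon>. 0 < \<epsilon> \<Longrightarrow> finer_at_scale (topspace X) \<rho> \<epsilon> d"
  shows "d \<in> Comp X"
proof -
  let ?S = "topspace X"
  interpret R: Metric_space ?S \<rho> by (fact R)
  have d': "pseudometric_on ?S d"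
    and cont_d: "continuous_map (prod_topology X X) euclideanreal (\<lambda>p. d (fst p) (snd p))"
    using d by (auto simp: CPM_def case_prod_unfold)
  have "x = y" if S: "x \<in> ?S" "y \<in> ?S" and "d x y = 0" for x y
  proof (rule ccontr)
    assume "x \<noteq> y"
    then have "0 < \<rho> x y"
      using S R.mdist_pos_less by blast
    then show False
      using finer[of "\<rho> x y"] S \<open>d x y = 0\<close> unfolding finer_at_scale_def by fastforce
  qed
  moreover have "d x y = 0" if "x \<notin> ?S \<or> y \<notin> ?S" for x y
    using d' that unfolding pseudometric_on_def by blast
  ultimately have E: "Metric_space ?S d"
    using Metric_space_iff_pseudometric_on[of ?S d] d' by blast
  then interpret E: Metric_space ?S d .

  have ball_open: "openin X (E.mball x r)" if "x \<in> ?S" for x r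
  proof -
    have "continuous_map X (prod_topology X X) (\<lambda>y. (x, y))"
      using that by (simp add: continuous_map_pairedI)
    from continuous_map_compose[OF this cont_d]
    have "continuous_map X euclideanreal (\<lambda>y. d x y)"
      by (simp add: o_def)
    then have "openin X {y \<in> ?S. d x y \<in> {..<r}}"
      by (rule openin_continuous_map_preimage) auto
    moreover have "E.mball x r = {y \<in> ?S. d x y \<in> {..<r}}"
      using that by (auto simp: E.mball_def)
    ultimately show ?thesis by simp
  qed
  have E_top: "E.mtopology = X"
    unfolding topology_eq
  proof (intro allI iffI)
    fix U assume U: "openin E.mtopology U"
    show "openin X U"
    proof (subst openin_subopen, intro ballI)
      fix x assume "x \<in> U"
      then obtain r where "r > 0" "E.mball x r \<subseteq> U" "x \<in> ?S"
        using U unfolding E.openin_mtopology by blast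
      then show "\<exists>T. openin X T \<and> x \<in> T \<and> T \<subseteq> U"
        using ball_open by (intro exI[of _ "E.mball x r"]) auto
    qed
  next
    fix U assume "openin X U"
    then have U: "openin R.mtopology U"
      by (simp add: top)
    have "\<exists>\<delta>>0. E.mball x \<delta> \<subseteq> U" if x: "x \<in> U" for x
    proof -
      obtain r where r: "r > 0" "R.mball x r \<subseteq> U"
        using U x unfolding R.openin_mtopology by blast
      obtain \<delta> where "\<delta> > 0" "\<forall>x\<in>?S. \<forall>y\<in>?S. d x y < \<delta> \<longrightarrow> \<rho> x y < r"
        using finer[OF r(1)] unfolding finer_at_scale_def by blast
      then have "E.mball x \<delta> \<subseteq> R.mball x r"
        by auto
      with r \<open>\<delta> > 0\<close> show ?thesis by blast
    qed
    then show "openin E.mtopology U"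
      using U unfolding E.openin_mtopology R.openin_mtopology by blast
  qed

  have "E.mcomplete"
    unfolding E.mcomplete_def
  proof (intro allI impI)
    fix \<sigma> assume \<sigma>: "E.MCauchy \<sigma>"
    then have S: "\<sigma> n \<in> ?S" for n
      unfolding E.MCauchy_def by blast
    have "R.MCauchy \<sigma>"
      unfolding R.MCauchy_def
    proof (intro conjI allI impI)
      fix \<epsilon> :: real assume "0 < \<epsilon>"
      then obtain \<delta> where "\<delta> > 0" "\<forall>x\<in>?S. \<forall>y\<in>?S. d x y < \<delta> \<longrightarrow> \<rho> x y < \<epsilon>"
        using finer unfolding finer_at_scale_def by blast
      then show "\<exists>N. \<forall>n n'. N \<le> n \<longrightarrow> N \<le> n' \<longrightarrow> \<rho> (\<sigma> n) (\<sigma> n') < \<epsilon>"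
        using \<sigma> S unfolding E.MCauchy_def by meson
    qed (use S in blast)
    then show "\<exists>x. limitin E.mtopology \<sigma> x sequentially"
      using complete unfolding R.mcomplete_def E_top top by blast
  qed
  then show ?thesis
    using d' E E_top by (simp add: Comp_def Met_def)
qed

text \<open>
  The upper bound \<open>CPM X\<close> ensures that every element of \<open>T\<close> can be perturbed; the lower bound
  \<open>Comp X\<close> ensures that the result of the perturbation is again in \<open>T\<close>.
\<close>

lemma Comp_comeager_in_between:
  assumes X: "completely_metrizable_space X" and T: "Comp X \<subseteq> T" "T \<subseteq> CPM X"
  shows "comeager_in (ball_topology T (sup_dist X)) (Comp X)"
proof -
  let ?S = "topspace X"
  obtain M \<rho> where M: "Metric_space M \<rho>" "Metric_space.mcomplete M \<rho>"
      "X = Metric_space.mtopology M \<rho>"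
    using X unfolding completely_metrizable_space_def by blast
  then have "?S = M"
    using Metric_space.topspace_mtopology by blast
  with M have R: "Metric_space ?S \<rho>" "Metric_space.mtopology ?S \<rho> = X"
      "Metric_space.mcomplete ?S \<rho>"
    by simp_all
  define G where "G n = {d \<in> T. finer_at_scale ?S \<rho> (inverse (real (Suc n))) d}" for n

  have "openin (ball_topology T (sup_dist X)) (G n)" for n
    unfolding openin_ball_topology
  proof (intro conjI ballI)
    fix d assume "d \<in> G n"
    then obtain r where "0 < r" "\<And>e. sup_dist X d e < ennreal r \<Longrightarrow>
        finer_at_scale ?S \<rho> (inverse (real (Suc n))) e"
      using finer_at_scale_open unfolding G_def by blast
    then show "\<exists>r. 0 < r \<and> {e \<in> T. sup_dist X d e < ennreal r} \<subseteq> G n"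
      unfolding G_def by blast
  qed (auto simp: G_def)
  moreover have "ball_topology T (sup_dist X) closure_of G n = T" for n
  proof (rule closure_of_ball_topology_eq_carrier)
    fix d and r :: real assume "d \<in> T" and r: "0 < r"
    then have d: "d \<in> CPM X"
      using T(2) by blast
    let ?e = "perturb ?S \<rho> (r / 2) d"
    have finer: "finer_at_scale ?S \<rho> \<epsilon> ?e" if "0 < \<epsilon>" for \<epsilon>
      using that d r by (intro perturb_finer_at_scale) (auto simp: CPM_def)
    have "?e \<in> CPM X"
      using R(1,2) d r by (intro perturb_in_CPM) auto
    then have "?e \<in> T"
      using uniformly_finer_imp_Comp[OF R _ finer] T(1) by blast
    then have "?e \<in> G n"
      using finer by (simp add: G_def)
    moreover have "sup_dist X d ?e < ennreal r"
      using sup_dist_perturb_le[OF R(1), of "r / 2" d] r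
      by (rule_tac le_less_trans) (auto simp: ennreal_less_iff)
    ultimately show "\<exists>e\<in>G n \<inter> T. sup_dist X d e < ennreal r"
      using \<open>?e \<in> T\<close> by blast
  qed
  moreover have "(\<Inter>n. G n) \<subseteq> Comp X"
  proof
    fix d assume d: "d \<in> (\<Inter>n. G n)"
    have "finer_at_scale ?S \<rho> \<epsilon> d" if \<epsilon>: "0 < \<epsilon>" for \<epsilon>
    proof -
      obtain n where "inverse (real (Suc n)) < \<epsilon>"
        using reals_Archimedean[OF \<epsilon>] by blast
      moreover have "finer_at_scale ?S \<rho> (inverse (real (Suc n))) d"
        using d by (simp add: G_def)
      ultimately show ?thesis
        unfolding finer_at_scale_def by (meson less_trans)
    qed
    moreover have "d \<in> CPM X"
      using d T(2) by (auto simp: G_def)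
    ultimately show "d \<in> Comp X"
      using uniformly_finer_imp_Comp[OF R] by blast
  qed
  ultimately show ?thesis
    unfolding comeager_in_def using T(1) by auto
qed

theorem theorem1p4:
  fixes X :: "'a topology"
  assumes "completely_metrizable_space X"
  shows "comeager_in (ball_topology (CPM X) (sup_dist X)) (Comp X) \<and>
         comeager_in (ball_topology (Met X) (sup_dist X)) (Comp X)"
proof -
  have "Comp X \<subseteq> Met X"
    by (auto simp: Comp_def)
  then show ?thesis
    using Comp_comeager_in_between[OF assms] Met_subset_CPM[of X] by blast
qed

end
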